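(* For every positive integer $n$: (a) $M_2(S_n\times S_n)\ge (n-1)!$; (b) $M_{2,n}(S_n\times S_n)\ge n!$; (c) $M_2(A_n\times A_n)\ge (n-1)!/2$; (d) $M_{2,n}(A_n\times A_n)\ge n!/2$.
   Context: For a group $\Gamma$ and positive integers $k,g$, a set $A\subseteq\Gamma$ is an $S_k[g]$-set if for every $\mu\in\Gamma$ there are at most $g$ words $(\alpha_1,\ldots,\alpha_k)\in A^k$ with $\alpha_1\cdots\alpha_k=\mu$; an $S_k$-set is an $S_k[1]$-set. $M_{k,g}(\Gamma)$ is the maximum size of an $S_k[g]$-set in $\Gamma$, and $M_k(\Gamma)=M_{k,1}(\Gamma)$. $S_n$ and $A_n$ are the symmetric and alternating groups on $n$ letters. *)

theory Defs
  imports Complex_Main "HOL-Algebra.Sym_Groups"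
begin

definition word_prod :: "('a, 'b) monoid_scheme \<Rightarrow> 'a list \<Rightarrow> 'a" where
  "word_prod G w = foldr (mult G) w (one G)"

text \<open>
  Finiteness of the set of words is demanded explicitly, because the cardinality of an
  infinite set is 0 in HOL.
\<close>

definition S_set :: "('a, 'b) monoid_scheme \<Rightarrow> nat \<Rightarrow> nat \<Rightarrow> 'a set \<Rightarrow> bool" where
  "S_set G k g A \<longleftrightarrow>
     A \<subseteq> carrier G \<and>
     (\<forall>\<mu> \<in> carrier G.
        finite {w. length w = k \<and> set w \<subseteq> A \<and> word_prod G w = \<mu>} \<and>
        card {w. length w = k \<and> set w \<subseteq> A \<and> word_prod G w = \<mu>} \<le> g)"

text \<open>
  The maximum is taken as a natural number, so it is meaningful only for groups with
  finite carrier (where the set below is finite, and non-empty since the empty set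
  qualifies for positive \<open>k\<close>).
\<close>

definition max_S_set_size :: "nat \<Rightarrow> nat \<Rightarrow> ('a, 'b) monoid_scheme \<Rightarrow> nat" where
  "max_S_set_size k g G = Max {card A |A. S_set G k g A}"

abbreviation max_S1_set_size :: "nat \<Rightarrow> ('a, 'b) monoid_scheme \<Rightarrow> nat" where
  "max_S1_set_size k G \<equiv> max_S_set_size k 1 G"

end

theory Submission
  imports Defs "HOL-Algebra.Group_Action"
begin

text \<open>
  For a fixed \<open>c\<close> take all pairs \<open>(x, x c)\<close> with \<open>x\<close> in a subgroup \<open>H\<close>. If \<open>x y = \<mu>\<close> and
  \<open>x c y c = \<nu>\<close>, then \<open>x c x\<^sup>-\<^sup>1 = \<nu> c\<^sup>-\<^sup>1 \<mu>\<^sup>-\<^sup>1\<close>, so the number of words is at most the number of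
  elements of \<open>H\<close> that commute with \<open>c\<close>. When \<open>c\<close> is a cycle of length \<open>n\<close> or \<open>n - 1\<close> through
  the point 1, an element of the centralizer fixing 1 is trivial. Hence the centralizer has at most
  \<open>n\<close> elements, and taking for \<open>H\<close> the whole group gives at most \<open>n\<close> words; taking for \<open>H\<close> the
  stabilizer of 1, whose index is at most \<open>n\<close>, gives at most one. Of the two cycle lengths the odd
  one is chosen, so that \<open>c\<close> is even and serves both the symmetric and the alternating group.
\<close>

lemma card_le_max_S_set_size:
  assumes "finite (carrier G)" and "S_set G k g A"
  shows "card A \<le> max_S_set_size k g G"
proof -
  have "{card A |A. S_set G k g A} \<subseteq> card ` Pow (carrier G)"
    by (auto simp: S_set_def)
  then have "finite {card A |A. S_set G k g A}"
    using assms(1) by (meson finite_Pow_iff finite_imageI finite_subset)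
  with assms(2) show ?thesis
    unfolding max_S_set_size_def by (intro Max_ge) auto
qed

lemma (in group) words_of_length_2_eq:
  assumes "A \<subseteq> carrier G" and "\<mu> \<in> carrier G"
  shows "{w. length w = 2 \<and> set w \<subseteq> A \<and> word_prod G w = \<mu>} =
    (\<lambda>x. [x, inv x \<otimes> \<mu>]) ` {x \<in> A. inv x \<otimes> \<mu> \<in> A}"
proof -
  have second_letter: "word_prod G [x, y] = \<mu> \<longleftrightarrow> y = inv x \<otimes> \<mu>" if "x \<in> A" "y \<in> A" for x y
    using that assms inv_solve_left[of y x \<mu>] by (auto simp: word_prod_def subset_iff)
  have "length w = 2 \<and> set w \<subseteq> A \<and> word_prod G w = \<mu> \<longleftrightarrow>
      (\<exists>x\<in>A. \<exists>y\<in>A. w = [x, y] \<and> word_prod G [x, y] = \<mu>)" for w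
    by (auto simp: numeral_2_eq_2 length_Suc_conv)
  also have "\<dots> w \<longleftrightarrow> (\<exists>x\<in>A. \<exists>y\<in>A. w = [x, y] \<and> y = inv x \<otimes> \<mu>)" for w
    using second_letter by blast
  finally show ?thesis
    by blast
qed

lemma (in group) S_set_2_iff:
  "S_set G 2 g A \<longleftrightarrow> A \<subseteq> carrier G \<and>
    (\<forall>\<mu>\<in>carrier G. finite {x \<in> A. inv x \<otimes> \<mu> \<in> A} \<and> card {x \<in> A. inv x \<otimes> \<mu> \<in> A} \<le> g)"
proof -
  have "inj_on (\<lambda>x. [x, inv x \<otimes> \<mu>]) X" for \<mu> X
    by (auto intro: inj_onI)
  then show ?thesis
    by (auto simp: S_set_def words_of_length_2_eq card_image finite_image_iff)
qed

definition twisted_diagonal :: "('a, 'b) monoid_scheme \<Rightarrow> 'a \<Rightarrow> 'a set \<Rightarrow> ('a \<times> 'a) set" where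
  "twisted_diagonal G c B = (\<lambda>x. (x, x \<otimes>\<^bsub>G\<^esub> c)) ` B"

lemma card_twisted_diagonal: "card (twisted_diagonal G c B) = card B"
  by (simp add: twisted_diagonal_def card_image inj_on_def)

lemma (in group) conjugate_eq_iff_inv_mult_eq:
  assumes "x \<in> carrier G" "c \<in> carrier G" "\<mu> \<in> carrier G" "\<nu> \<in> carrier G"
  shows "x \<otimes> c \<otimes> inv x = \<nu> \<otimes> inv (\<mu> \<otimes> c) \<longleftrightarrow> inv (x \<otimes> c) \<otimes> \<nu> = inv x \<otimes> \<mu> \<otimes> c"
proof -
  have "x \<otimes> c \<otimes> inv x = \<nu> \<otimes> inv (\<mu> \<otimes> c) \<longleftrightarrow> \<nu> = x \<otimes> c \<otimes> inv x \<otimes> (\<mu> \<otimes> c)"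
    using assms by (intro inv_solve_right) simp_all
  also have "x \<otimes> c \<otimes> inv x \<otimes> (\<mu> \<otimes> c) = x \<otimes> c \<otimes> (inv x \<otimes> \<mu> \<otimes> c)"
    using assms by (simp add: m_assoc)
  also have "\<nu> = \<dots> \<longleftrightarrow> inv (x \<otimes> c) \<otimes> \<nu> = inv x \<otimes> \<mu> \<otimes> c"
    using assms by (intro inv_solve_left'[symmetric]) simp_all
  finally show ?thesis .
qed

lemma (in group) S_set_twisted_diagonal:
  assumes B_subset: "B \<subseteq> carrier G" and c_closed: "c \<in> carrier G"
    and conj_fibres: "\<And>d. d \<in> carrier G \<Longrightarrow>
      finite {x \<in> B. x \<otimes> c \<otimes> inv x = d} \<and> card {x \<in> B. x \<otimes> c \<otimes> inv x = d} \<le> g"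
  shows "S_set (G \<times>\<times> G) 2 g (twisted_diagonal G c B)"
proof -
  interpret GG: group "G \<times>\<times> G"
    using is_group is_group by (rule DirProd_group)
  let ?D = "twisted_diagonal G c B"
  have "finite {u \<in> ?D. inv\<^bsub>G \<times>\<times> G\<^esub> u \<otimes>\<^bsub>G \<times>\<times> G\<^esub> (\<mu>, \<nu>) \<in> ?D} \<and>
      card {u \<in> ?D. inv\<^bsub>G \<times>\<times> G\<^esub> u \<otimes>\<^bsub>G \<times>\<times> G\<^esub> (\<mu>, \<nu>) \<in> ?D} \<le> g"
    (is "finite ?U \<and> card ?U \<le> g")
    if "\<mu> \<in> carrier G" "\<nu> \<in> carrier G" for \<mu> \<nu>
  proof -
    let ?F = "{x \<in> B. x \<otimes> c \<otimes> inv x = \<nu> \<otimes> inv (\<mu> \<otimes> c)}"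
    have "?U \<subseteq> (\<lambda>x. (x, x \<otimes> c)) ` ?F"
      using B_subset c_closed that
      by (auto simp: twisted_diagonal_def inv_DirProd[OF is_group is_group]
          conjugate_eq_iff_inv_mult_eq subset_iff)
    moreover have "finite ?F \<and> card ?F \<le> g"
      using that c_closed by (intro conj_fibres) simp
    ultimately show ?thesis
      by (meson card_image_le card_mono finite_imageI finite_subset order_trans)
  qed
  moreover have "?D \<subseteq> carrier (G \<times>\<times> G)"
    using B_subset c_closed by (auto simp: twisted_diagonal_def)
  ultimately show ?thesis
    by (auto simp: GG.S_set_2_iff)
qed

definition centralizer :: "('a, 'b) monoid_scheme \<Rightarrow> 'a \<Rightarrow> 'a set" where
  "centralizer G c = {z \<in> carrier G. c \<otimes>\<^bsub>G\<^esub> z = z \<otimes>\<^bsub>G\<^esub> c}"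

lemma (in group) stabilizer_conjugation_eq_centralizer:
  assumes "c \<in> carrier G"
  shows "stabilizer G (\<lambda>g. \<lambda>h\<in>carrier G. g \<otimes> h \<otimes> inv g) c = centralizer G c"
  using assms by (auto simp: stabilizer_def centralizer_def inv_solve_right')

lemma (in group) subgroup_centralizer:
  assumes "c \<in> carrier G"
  shows "subgroup (centralizer G c) G"
  using group_action.stabilizer_subgroup[OF action_by_conjugation assms]
  by (simp only: stabilizer_conjugation_eq_centralizer[OF assms])

lemma (in group_action) finite_card_transporter_le:
  assumes x_in_E: "x \<in> E" and finite_stabilizer: "finite (stabilizer G \<phi> x)"
  shows "finite {g \<in> carrier G. \<phi> g x = y} \<and>
    card {g \<in> carrier G. \<phi> g x = y} \<le> card (stabilizer G \<phi> x)"
    (is "finite ?T \<and> card ?T \<le> _")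
proof (cases "?T = {}")
  case True
  then show ?thesis
    by (simp only: finite.emptyI card.empty zero_le simp_thms)
next
  case False
  interpret group G
    using group_hom by (rule group_hom.axioms(1))
  obtain a where a: "a \<in> carrier G" "\<phi> a x = y"
    using False by blast
  have "inv a \<otimes> g \<in> stabilizer G \<phi> x" if "g \<in> ?T" for g
    using that a composition_rule[OF x_in_E, of "inv a" g] orbit_sym_aux[OF a(1) x_in_E a(2)]
    by (simp add: stabilizer_def)
  then have into_stabilizer: "(\<lambda>g. inv a \<otimes> g) ` ?T \<subseteq> stabilizer G \<phi> x"
    by blast
  have inj: "inj_on (\<lambda>g. inv a \<otimes> g) ?T"
    using a(1) by (intro inj_onI) simp
  show ?thesis
    using inj_on_finite[OF inj into_stabilizer finite_stabilizer]
      card_inj_on_le[OF inj into_stabilizer finite_stabilizer] by (rule conjI)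
qed

lemma (in group) S_set_twisted_diagonal_subgroup:
  assumes subgroup_H: "subgroup H G" and c_closed: "c \<in> carrier G"
    and "finite (H \<inter> centralizer G c)" and "card (H \<inter> centralizer G c) \<le> g"
  shows "S_set (G \<times>\<times> G) 2 g (twisted_diagonal G c H)"
proof (rule S_set_twisted_diagonal[OF subgroup.subset[OF subgroup_H] c_closed])
  let ?conj = "\<lambda>g. \<lambda>h\<in>carrier G. g \<otimes> h \<otimes> inv g"
  interpret group_action "G\<lparr>carrier := H\<rparr>" "carrier G" ?conj
    using action_by_conjugation subgroup_H by (rule group_action.induced_action)
  have "stabilizer (G\<lparr>carrier := H\<rparr>) ?conj c = H \<inter> stabilizer G ?conj c"
    using subgroup.subset[OF subgroup_H] by (auto simp: stabilizer_def)
  then have "stabilizer (G\<lparr>carrier := H\<rparr>) ?conj c = H \<inter> centralizer G c"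
    by (simp only: stabilizer_conjugation_eq_centralizer[OF c_closed])
  then show "finite {x \<in> H. x \<otimes> c \<otimes> inv x = d} \<and> card {x \<in> H. x \<otimes> c \<otimes> inv x = d} \<le> g" for d
    using finite_card_transporter_le[OF c_closed, of d] assms by simp
qed

lemma (in group) card_subgroup_le_max_S_set_size:
  assumes "finite (carrier G)" and "subgroup H G" and "c \<in> carrier G"
    and "card (H \<inter> centralizer G c) \<le> g"
  shows "card H \<le> max_S_set_size 2 g (G \<times>\<times> G)"
proof -
  have "finite (H \<inter> centralizer G c)"
    using assms(1) subgroup.subset[OF assms(2)] by (meson finite_Int finite_subset)
  then have "S_set (G \<times>\<times> G) 2 g (twisted_diagonal G c H)"
    using assms by (intro S_set_twisted_diagonal_subgroup)
  then have "card (twisted_diagonal G c H) \<le> max_S_set_size 2 g (G \<times>\<times> G)"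
    using assms(1) by (intro card_le_max_S_set_size) simp_all
  then show ?thesis
    by (simp only: card_twisted_diagonal)
qed

lemma (in group_action) order_le_card_mult_card_stabilizer:
  assumes "finite E" and "x \<in> E"
  shows "order G \<le> card E * card (stabilizer G \<phi> x)"
proof -
  have "orbit G \<phi> x \<subseteq> E"
    using element_image[OF _ assms(2)] by (auto simp: orbit_def)
  then have "card (orbit G \<phi> x) \<le> card E"
    using assms(1) by (intro card_mono)
  then show ?thesis
    using orbit_stabilizer_theorem[OF assms(2)] by (metis mult_le_mono1)
qed

lemma (in group_action) order_le_max_S_set_size:
  assumes finite_G: "finite (carrier G)" and finite_E: "finite E"
    and x_in_E: "x \<in> E" and c_closed: "c \<in> carrier G"
    and trivial_Int: "stabilizer G \<phi> x \<inter> centralizer G c = {\<one>}"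
  shows "order G \<le> card E * max_S1_set_size 2 (G \<times>\<times> G)"
    and "order G \<le> max_S_set_size 2 (card E) (G \<times>\<times> G)"
proof -
  interpret group G
    using group_hom by (rule group_hom.axioms(1))
  have "card (stabilizer G \<phi> x) \<le> max_S1_set_size 2 (G \<times>\<times> G)"
    using trivial_Int
    by (intro card_subgroup_le_max_S_set_size[OF finite_G stabilizer_subgroup[OF x_in_E] c_closed])
      simp
  then show "order G \<le> card E * max_S1_set_size 2 (G \<times>\<times> G)"
    using order_le_card_mult_card_stabilizer[OF finite_E x_in_E] by (meson mult_le_mono2 order_trans)
  let ?C = "G\<lparr>carrier := centralizer G c\<rparr>"
  interpret C: group_action ?C E \<phi>
    using subgroup_centralizer[OF c_closed] by (rule induced_action)
  have "stabilizer ?C \<phi> x = stabilizer G \<phi> x \<inter> centralizer G c"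
    by (auto simp: stabilizer_def centralizer_def)
  then have "card (centralizer G c) \<le> card E"
    using C.order_le_card_mult_card_stabilizer[OF finite_E x_in_E]
    by (simp add: trivial_Int order_def)
  moreover have "carrier G \<inter> centralizer G c = centralizer G c"
    by (auto simp: centralizer_def)
  ultimately show "order G \<le> max_S_set_size 2 (card E) (G \<times>\<times> G)"
    unfolding order_def
    by (intro card_subgroup_le_max_S_set_size[OF finite_G subgroup_self c_closed]) simp
qed

lemma evenperm_cycle_of_list:
  assumes "cycle cs"
  shows "evenperm (cycle_of_list cs) \<longleftrightarrow> even (length cs - 1)"
  using swapidseq_ext_imp_swapidseq[OF swapidseq_ext_of_cycles[OF assms]] refl
  by (rule evenperm_unique)

lemma cycle_of_list_funpow_transitive:
  assumes "cycle cs" and "i \<in> set cs" and "j \<in> set cs"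
  shows "\<exists>k. (cycle_of_list cs ^^ k) i = j"
proof -
  obtain a b where a: "a < length cs" "cs ! a = i" and b: "b < length cs" "cs ! b = j"
    using assms(2,3) by (meson in_set_conv_nth)
  define k where "k = b + (length cs - a)"
  have "(cycle_of_list cs ^^ k) i = rotate k cs ! a"
    using a by (simp flip: cyclic_rotation[OF assms(1)])
  also have "\<dots> = cs ! ((k + a) mod length cs)"
    using a(1) by (rule nth_rotate)
  also have "\<dots> = j"
    using a(1) b by (simp add: k_def)
  finally show ?thesis ..
qed

lemma commutes_with_cycle_imp_eq_id:
  assumes z_permutes: "z permutes S" and cycle_cs: "cycle cs"
    and commutes: "cycle_of_list cs \<circ> z = z \<circ> cycle_of_list cs"
    and fixed_point: "i \<in> set cs" "z i = i"
    and S_minus_cycle: "S - set cs \<subseteq> {a}"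
  shows "z = id"
proof -
  have "z j = j" if "j \<in> set cs" for j
  proof -
    obtain k where "(cycle_of_list cs ^^ k) i = j"
      using cycle_of_list_funpow_transitive[OF cycle_cs fixed_point(1) \<open>j \<in> set cs\<close>] by blast
    moreover have "z ((cycle_of_list cs ^^ m) i) = (cycle_of_list cs ^^ m) (z i)" for m
      by (induction m) (simp_all add: fun_cong[OF commutes, unfolded o_apply, symmetric])
    ultimately show ?thesis
      using fixed_point(2) by metis
  qed
  then have "z permutes {a}"
    using S_minus_cycle by (intro permutes_superset[OF z_permutes]) blast
  then show ?thesis
    by simp
qed

lemma group_action_sym_group: "group_action (sym_group n) {1..n} (\<lambda>p. restrict p {1..n})"
proof -
  have "restrict p {1..n} \<in> Bij {1..n}" if "p permutes {1..n}" for p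
    using permutes_imp_bij[OF that] by (simp add: Bij_def)
  then have "(\<lambda>p. restrict p {1..n}) \<in> hom (sym_group n) (BijGroup {1..n})"
    by (auto simp: hom_def BijGroup_def sym_group_def permutes_compose compose_def
        permutes_in_image simp del: atLeastAtMost_iff)
  then show ?thesis
    by (intro group_action.intro group_hom.intro group_hom_axioms.intro
        sym_group_is_group group_BijGroup)
qed

lemma ex_alt_group_stabilizer_Int_centralizer_trivial:
  assumes "n \<ge> 1"
  shows "\<exists>c\<in>carrier (alt_group n).
    stabilizer (sym_group n) (\<lambda>p. restrict p {1..n}) 1 \<inter> centralizer (sym_group n) c = {id}"
proof
  define k where "k = (if odd n then n else n - 1)"
  have k_props: "odd k" "1 \<le> k" "k \<le> n" "n \<le> Suc k"
    using assms by (auto simp: k_def elim!: evenE)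
  define cs where "cs = [1..<Suc k]"
  have cs_props: "cycle cs" "length cs = k" "set cs = {1..k}"
    by (auto simp: cs_def)
  have "cycle_of_list cs permutes {1..n}"
    using k_props(3) by (intro permutes_subset[OF cycle_permutes]) (simp add: cs_props)
  then show "cycle_of_list cs \<in> carrier (alt_group n)"
    using k_props(1) by (simp add: alt_group_carrier evenperm_cycle_of_list cs_props)
  have "1 \<in> set cs" "{1..n} - set cs \<subseteq> {n}"
    using k_props by (auto simp: cs_props)
  then have "z = id"
    if "z permutes {1..n}" "cycle_of_list cs \<circ> z = z \<circ> cycle_of_list cs" "z 1 = 1" for z
    using commutes_with_cycle_imp_eq_id[OF that(1) cs_props(1) that(2)] that(3) by blast
  then show "stabilizer (sym_group n) (\<lambda>p. restrict p {1..n}) 1 \<inter>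
      centralizer (sym_group n) (cycle_of_list cs) = {id}"
    using assms by (auto simp: stabilizer_def centralizer_def sym_group_def)
qed

lemma card_le_max_S_set_size_between_alt_sym:
  assumes "n \<ge> 1" and subgroup_H: "subgroup H (sym_group n)"
    and alt_subset: "carrier (alt_group n) \<subseteq> H"
  defines "G \<equiv> sym_group n\<lparr>carrier := H\<rparr>"
  shows "card H \<le> n * max_S1_set_size 2 (G \<times>\<times> G)"
    and "card H \<le> max_S_set_size 2 n (G \<times>\<times> G)"
proof -
  let ?\<phi> = "\<lambda>p. restrict p {1..n}"
  interpret group_action G "{1..n}" ?\<phi>
    unfolding G_def using group_action_sym_group subgroup_H by (rule group_action.induced_action)
  have H_subset: "H \<subseteq> carrier (sym_group n)"
    using subgroup_H by (rule subgroup.subset)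
  obtain c where c_alt: "c \<in> carrier (alt_group n)"
    and trivial_Int: "stabilizer (sym_group n) ?\<phi> 1 \<inter> centralizer (sym_group n) c = {id}"
    using ex_alt_group_stabilizer_Int_centralizer_trivial[OF assms(1)] by blast
  have "finite (carrier (sym_group n))"
    by (simp add: sym_group_def finite_permutations)
  then have "finite (carrier G)"
    using H_subset by (auto simp: G_def intro: finite_subset)
  moreover have "stabilizer G ?\<phi> 1 \<inter> centralizer G c =
      H \<inter> (stabilizer (sym_group n) ?\<phi> 1 \<inter> centralizer (sym_group n) c)"
    using H_subset by (auto simp: G_def stabilizer_def centralizer_def)
  with trivial_Int have "stabilizer G ?\<phi> 1 \<inter> centralizer G c = {\<one>\<^bsub>G\<^esub>}"
    using subgroup.one_closed[OF subgroup_H] by (simp add: G_def sym_group_one)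
  ultimately show "card H \<le> n * max_S1_set_size 2 (G \<times>\<times> G)"
    and "card H \<le> max_S_set_size 2 n (G \<times>\<times> G)"
    using order_le_max_S_set_size[of 1 c] c_alt alt_subset assms(1)
    by (auto simp: order_def G_def)
qed

lemma fact_le_mult_iff: "n \<ge> 1 \<Longrightarrow> fact n \<le> n * m \<longleftrightarrow> fact (n - 1) \<le> m" for m n :: nat
  by (simp add: fact_reduce[of n])

lemma fact_le_max_S_set_size_sym_group:
  assumes "n \<ge> 1"
  shows "fact (n - 1) \<le> max_S1_set_size 2 (sym_group n \<times>\<times> sym_group n)"
    and "fact n \<le> max_S_set_size 2 n (sym_group n \<times>\<times> sym_group n)"
proof -
  have "sym_group n\<lparr>carrier := carrier (sym_group n)\<rparr> = sym_group n"
    by simp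
  then have "fact n \<le> n * max_S1_set_size 2 (sym_group n \<times>\<times> sym_group n)"
    and "fact n \<le> max_S_set_size 2 n (sym_group n \<times>\<times> sym_group n)"
    using card_le_max_S_set_size_between_alt_sym[OF assms
        group.subgroup_self[OF sym_group_is_group] subgroup.subset[OF alt_group_is_subgroup]]
    by (simp_all add: sym_group_card_carrier)
  then show "fact (n - 1) \<le> max_S1_set_size 2 (sym_group n \<times>\<times> sym_group n)"
    and "fact n \<le> max_S_set_size 2 n (sym_group n \<times>\<times> sym_group n)"
    by (simp_all only: fact_le_mult_iff[OF assms])
qed

lemma fact_le_double_card_alt_group: "fact n \<le> 2 * card (carrier (alt_group n))"
proof (cases "n \<ge> 2")
  case True
  then show ?thesis
    by (simp add: alt_group_card_carrier)
next
  case False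
  then have "n = 0 \<or> n = 1"
    by auto
  moreover from this have "carrier (alt_group n) = {id}"
    by (auto simp: alt_group_carrier)
  ultimately show ?thesis
    by auto
qed

lemma fact_le_double_max_S_set_size_alt_group:
  assumes "n \<ge> 1"
  shows "fact (n - 1) \<le> 2 * max_S1_set_size 2 (alt_group n \<times>\<times> alt_group n)"
    and "fact n \<le> 2 * max_S_set_size 2 n (alt_group n \<times>\<times> alt_group n)"
proof -
  have "sym_group n\<lparr>carrier := carrier (alt_group n)\<rparr> = alt_group n"
    by (simp add: alt_group_def)
  then have "fact n \<le> n * (2 * max_S1_set_size 2 (alt_group n \<times>\<times> alt_group n))"
    and "fact n \<le> 2 * max_S_set_size 2 n (alt_group n \<times>\<times> alt_group n)"
    using card_le_max_S_set_size_between_alt_sym[OF assms alt_group_is_subgroup order_refl]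
      fact_le_double_card_alt_group[of n] by simp_all
  then show "fact (n - 1) \<le> 2 * max_S1_set_size 2 (alt_group n \<times>\<times> alt_group n)"
    and "fact n \<le> 2 * max_S_set_size 2 n (alt_group n \<times>\<times> alt_group n)"
    by (simp_all only: fact_le_mult_iff[OF assms])
qed

theorem theorem1p8:
  fixes n :: nat
  assumes "n \<ge> 1"
  shows "max_S1_set_size 2 (sym_group n \<times>\<times> sym_group n) \<ge> fact (n - 1) \<and>
         max_S_set_size 2 n (sym_group n \<times>\<times> sym_group n) \<ge> fact n \<and>
         real (max_S1_set_size 2 (alt_group n \<times>\<times> alt_group n)) \<ge> fact (n - 1) / 2 \<and>
         real (max_S_set_size 2 n (alt_group n \<times>\<times> alt_group n)) \<ge> fact n / 2"
proof -
  have fact_half_le: "fact m / 2 \<le> real k" if "fact m \<le> 2 * k" for m k :: nat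
    using of_nat_mono[OF that, where ?'a = real] by simp
  show ?thesis
    using fact_le_max_S_set_size_sym_group[OF assms]
      fact_le_double_max_S_set_size_alt_group[OF assms]
    by (intro conjI fact_half_le)
qed

end
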